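(* Let $k=k_n$ be positive integers with $n>2k$, and let a random family of $k$-element subsets of an $n$-element set be obtained by selecting each of the $\binom{n}{k}$ $k$-sets independently with probability $p$. Let $b$ be a nonnegative integer (which may depend on $n$). For $0\le j\le b$ let $X_j$ be the number of (unordered) pairs of selected sets which overlap in exactly $j$ elements, and let $\lambda_j=\mathbb{E}(X_j)=\frac12\binom{n}{k}\binom{k}{j}\binom{n-k}{k-j}p^2$. Then the joint distribution of $(X_0,X_1,\ldots,X_b)$ can be approximated by $b+1$ independent Poisson distributions, provided $b$ is "not too large" and provided the probability $p$ of choosing any particular $k$-set satisfies $$p=o\left(\left(\frac{1}{\binom{n}{k}\left(\sum_{j=0}^{b}\binom{k}{j}\binom{n-k}{k-j}\right)^2}\right)^{1/3}\right).$$ In other words, the total variation distance between these two distributions satisfies $$d_{TV}\left(\mathcal{L}(X_0,X_1,\ldots,X_b),\ \prod_{j=0}^{b}\mathrm{Po}(\lambda_j)\right)\le \epsilon_{n,b,k},$$ where $\epsilon_{n,b,k}\to 0$ as $n,k\to\infty$.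
   Context: $\mathcal{L}(Z)$ denotes the distribution of the random vector $Z$, $\mathrm{Po}(\lambda)$ the Poisson distribution with mean $\lambda$, $\prod_{j=0}^b\mathrm{Po}(\lambda_j)$ the joint law of independent Poisson random variables with means $\lambda_0,\ldots,\lambda_b$, and $d_{TV}$ the usual total variation distance between probability distributions. Two sets overlap in exactly $j$ elements if their intersection has cardinality $j$. The phrase "not too large" is informal in the theorem itself. The accompanying discussion relates the permitted size of $b$ (for given $k$) to the condition $\left(\binom{n}{k}\binom{n-k}{k}\right)^{-1/2}\le\left(\binom{n}{k}\left(\sum_{j=0}^b\binom{k}{j}\binom{n-k}{k-j}\right)^2\right)^{-1/3}$, equivalently $\binom{n}{k}^{1/2}\binom{n-k}{k}^{3/2}\ge\left(\sum_{j=0}^b\binom{k}{j}\binom{n-k}{k-j}\right)^2$. It says that this condition tells how large $b$ may be before a Poisson approximation becomes unrealistic, while remarking that imposing it is not strictly required: it serves to make the range of $p$ reach the threshold for the family to be pairwise intersecting. *)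

theory Defs
  imports
    "HOL-Probability.Probability"
    "HOL-Library.Landau_Symbols"
    "HOL-Library.Ramsey"
begin

text \<open>The ground set is \<open>{..<n}\<close>; \<open>Pi_pmf\<close> makes the selection indicators of the \<open>k\<close>-sets
  independent.\<close>

definition random_family :: "nat \<Rightarrow> nat \<Rightarrow> real \<Rightarrow> nat set set pmf" where
  "random_family n k p =
     map_pmf (\<lambda>sel. {A \<in> [{..<n}]\<^bsup>k\<^esup>. sel A})
       (Pi_pmf ([{..<n}]\<^bsup>k\<^esup>) False (\<lambda>_. bernoulli_pmf p))"

definition overlap_pairs :: "'a set set \<Rightarrow> nat \<Rightarrow> 'a set set set" where
  "overlap_pairs F j = {{A, B} | A B. A \<in> F \<and> B \<in> F \<and> A \<noteq> B \<and> card (A \<inter> B) = j}"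

definition overlap_count :: "'a set set \<Rightarrow> nat \<Rightarrow> nat" where
  "overlap_count F j = card (overlap_pairs F j)"

text \<open>Vectors \<open>(x\<^sub>0, \<dots>, x\<^sub>b)\<close> are represented as functions on \<open>nat\<close> that vanish outside \<open>{..b}\<close>.\<close>

definition overlap_vector_pmf :: "nat \<Rightarrow> nat \<Rightarrow> real \<Rightarrow> nat \<Rightarrow> (nat \<Rightarrow> nat) pmf" where
  "overlap_vector_pmf n k p b =
     map_pmf (\<lambda>F j. if j \<le> b then overlap_count F j else 0) (random_family n k p)"

text \<open>For \<open>j \<noteq> k\<close> this closed form is the expected number of overlapping pairs. For \<open>j = k\<close> it is not:
  distinct \<open>k\<close>-sets cannot overlap in \<open>k\<close> elements, so that count is always \<open>0\<close>.\<close>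

definition overlap_mean :: "nat \<Rightarrow> nat \<Rightarrow> real \<Rightarrow> nat \<Rightarrow> real" where
  "overlap_mean n k p j =
     1 / 2 * real (n choose k) * real (k choose j) * real ((n - k) choose (k - j)) * p\<^sup>2"

text \<open>\<open>poisson_pmf\<close> is only specified for positive rates; mean \<open>0\<close> gives the point mass at \<open>0\<close>.\<close>

definition Po :: "real \<Rightarrow> nat pmf" where
  "Po rate = (if rate = 0 then return_pmf 0 else poisson_pmf rate)"

definition Po_product :: "nat \<Rightarrow> (nat \<Rightarrow> real) \<Rightarrow> (nat \<Rightarrow> nat) pmf" where
  "Po_product b rate = Pi_pmf {..b} 0 (\<lambda>j. Po (rate j))"

definition d_TV :: "'a pmf \<Rightarrow> 'a pmf \<Rightarrow> real" where
  "d_TV P Q = (SUP S. \<bar>measure_pmf.prob P S - measure_pmf.prob Q S\<bar>)"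

end

theory Submission
  imports Defs
begin

text \<open>Let \<open>G\<close> be the graph on the \<open>N = n choose k\<close> many \<open>k\<close>-sets in which two sets are joined when they
overlap in at most \<open>b\<close> elements, and let \<open>S\<close> be the sum in the hypothesis. For \<open>b < k\<close> the graph is
\<open>S\<close>-regular, so that it has \<open>N S / 2\<close> edges, and \<open>X\<^sub>j\<close> counts the edges of class \<open>j\<close> that lie inside
the random family. The hypothesis says \<open>N S\<^sup>2 p^3 \<rightarrow> 0\<close>, so the expected number of selected paths with two
edges tends to 0. Hence the selected edges form a matching with high probability, and nothing but
shared sets can make the edges dependent.

This heuristic turns into a proof by comparing probabilities pointwise. Let \<open>E\<close> be the edge set and
let \<open>M \<subseteq> E\<close> be such that no edge of \<open>G\<close> touches two members of \<open>M\<close>. The edges inside the random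
family are exactly those of \<open>M\<close> iff the \<open>2 |M|\<close> endpoints are selected and every other edge misses
at least one of its endpoints. Given the endpoints, the latter are decreasing events in the
remaining independent choices, so the Harris inequality bounds their joint probability below by the
product (\<open>prob_induced_matching_ge\<close>). Edges away from \<open>M\<close> contribute factors \<open>1 - p\<^sup>2\<close>, and the at
most \<open>2 S |M|\<close> edges that touch \<open>M\<close> contribute factors of at least \<open>1 - p\<close>. A Poisson process with
intensity \<open>p\<^sup>2\<close> on every edge takes the value \<open>M\<close> with probability \<open>(p\<^sup>2)^|M| * exp (- |E| p\<^sup>2)\<close>, and
the lower bound falls short of it by a relative error of at most \<open>|E| p^4 + 2 S |M| p\<close>. Under the Poisson process
the mean of this error and the probability of all other configurations are easy to compute, by
independence, and all are of order \<open>N S\<^sup>2 p^3\<close> as long as \<open>S p \<le> 1\<close>. A one-sided estimate of this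
kind already bounds the total variation distance, because both laws have total mass 1
(\<open>d_TV_le_density\<close>). The result is \<open>d_TV_induced_edges_Po_process_le\<close>. Adding up the Poisson
multiplicities within each class yields independent Poisson variables with the means \<open>\<lambda>\<^sub>j\<close>
(\<open>map_pmf_fibre_sums_Po\<close>).

For \<open>b \<ge> k\<close> the Vandermonde identity gives \<open>S = N\<close>, and the hypothesis becomes \<open>N p \<rightarrow> 0\<close>. Then
both vectors vanish with high probability (\<open>d_TV_overlap_vector_le_empty\<close>), which also disposes of
the component \<open>j = k\<close>, where the Poisson mean can be positive although the count is identically zero.\<close>

section \<open>Random subsets and the Harris inequality\<close>

definition random_subset :: "'a set \<Rightarrow> real \<Rightarrow> 'a set pmf" where
  "random_subset V p =
     map_pmf (\<lambda>s. {x \<in> V. s x}) (Pi_pmf V False (\<lambda>_. bernoulli_pmf p))"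

abbreviation subset_expectation :: "'a set \<Rightarrow> real \<Rightarrow> ('a set \<Rightarrow> real) \<Rightarrow> real" where
  "subset_expectation V p \<equiv> measure_pmf.expectation (random_subset V p)"

lemma random_subset_empty: "random_subset {} p = return_pmf {}"
  by (simp add: random_subset_def)

text \<open>Building a random subset one point at a time makes its expectations accessible to induction on the
ground set.\<close>

lemma random_subset_insert:
  assumes "finite V" "x \<notin> V"
  shows "random_subset (insert x V) p =
    bernoulli_pmf p \<bind> (\<lambda>b. map_pmf (if b then insert x else id) (random_subset V p))"
proof -
  have "random_subset (insert x V) p = bernoulli_pmf p \<bind> (\<lambda>b. map_pmf
      (\<lambda>f. {y \<in> insert x V. (f(x := b)) y}) (Pi_pmf V False (\<lambda>_. bernoulli_pmf p)))"
    unfolding random_subset_def Pi_pmf_insert[OF assms]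
    by (simp add: pair_pmf_def map_bind_pmf map_pmf_def bind_assoc_pmf bind_return_pmf)
  moreover have "{y \<in> insert x V. (f(x := b)) y} = (if b then insert x else id) {y \<in> V. f y}" for f b
    using assms by auto
  ultimately show ?thesis
    by (simp add: random_subset_def pmf.map_comp o_def)
qed

lemma set_random_subset: "set_pmf (random_subset V p) \<subseteq> Pow V"
  by (auto simp: random_subset_def)

lemma finite_set_random_subset: "finite V \<Longrightarrow> finite (set_pmf (random_subset V p))"
  using set_random_subset by (metis finite_Pow_iff finite_subset)

lemma integrable_random_subset [intro, simp]:
  "finite V \<Longrightarrow> integrable (measure_pmf (random_subset V p)) (h :: _ \<Rightarrow> real)"
  by (rule integrable_measure_pmf_finite[OF finite_set_random_subset])

lemma subset_expectation_cong:
  assumes "\<And>F. F \<subseteq> V \<Longrightarrow> f F = g F"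
  shows "subset_expectation V p f = subset_expectation V p g"
  using assms set_random_subset[of V p]
  by (intro integral_cong_AE) (auto simp: AE_measure_pmf_iff)

lemma subset_expectation_mono:
  assumes "finite V" "\<And>F. F \<subseteq> V \<Longrightarrow> f F \<le> g F"
  shows "subset_expectation V p f \<le> subset_expectation V p g"
  using assms set_random_subset[of V p]
  by (intro integral_mono_AE) (auto simp: AE_measure_pmf_iff)

lemma subset_expectation_empty: "subset_expectation {} p h = h {}"
  by (simp add: random_subset_empty)

lemma subset_expectation_insert:
  assumes "finite V" "x \<notin> V" "0 \<le> p" "p \<le> 1"
  shows "subset_expectation (insert x V) p h =
    p * subset_expectation V p (\<lambda>F. h (insert x F)) + (1 - p) * subset_expectation V p h"
proof -
  have "subset_expectation (insert x V) p h = (\<Sum>b\<in>UNIV. pmf (bernoulli_pmf p) b *\<^sub>R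
      measure_pmf.expectation (map_pmf (if b then insert x else id) (random_subset V p)) h)"
    unfolding random_subset_insert[OF assms(1,2)]
    by (rule pmf_expectation_bind) (auto simp: finite_set_random_subset assms(1))
  then show ?thesis
    using assms by (simp add: UNIV_bool)
qed

text \<open>Positive correlation of decreasing functions. Conditioning on the status of a new point \<open>x\<close>, the
conditional means \<open>a1, b1\<close> given \<open>x\<close> selected lie below the means \<open>a0, b0\<close> given \<open>x\<close> not selected,
and a two-point variable gives the covariance \<open>p (1 - p) (a0 - a1) (b0 - b1) \<ge> 0\<close>.\<close>

lemma harris_inequality:
  fixes f g :: "'a set \<Rightarrow> real"
  assumes "finite V" "0 \<le> p" "p \<le> 1"
    and "\<And>A B. A \<subseteq> B \<Longrightarrow> f B \<le> f A" "\<And>A B. A \<subseteq> B \<Longrightarrow> g B \<le> g A"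
  shows "subset_expectation V p f * subset_expectation V p g
    \<le> subset_expectation V p (\<lambda>F. f F * g F)"
  using assms(1,4,5)
proof (induction V arbitrary: f g rule: finite_induct)
  case empty
  then show ?case by (simp add: subset_expectation_empty)
next
  case (insert x V)
  let ?E = "subset_expectation V p"
  define a1 a0 b1 b0 where "a1 = ?E (\<lambda>F. f (insert x F))" "a0 = ?E f"
    "b1 = ?E (\<lambda>F. g (insert x F))" "b0 = ?E g"
  note d = this
  have "a1 \<le> a0" "b1 \<le> b0"
    unfolding d by (auto intro!: subset_expectation_mono insert.hyps insert.prems)
  then have "0 \<le> p * (1 - p) * ((a0 - a1) * (b0 - b1))"
    using assms by simp
  moreover have "(p * a1 + (1 - p) * a0) * (p * b1 + (1 - p) * b0)
      = p * (a1 * b1) + (1 - p) * (a0 * b0) - p * (1 - p) * ((a0 - a1) * (b0 - b1))"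
    by algebra
  moreover have "p * (a1 * b1) \<le> p * ?E (\<lambda>F. f (insert x F) * g (insert x F))"
    unfolding d by (intro mult_left_mono insert.IH assms(2)) (auto intro!: insert.prems)
  moreover have "(1 - p) * (a0 * b0) \<le> (1 - p) * ?E (\<lambda>F. f F * g F)"
    unfolding d using assms(3) by (intro mult_left_mono insert.IH) (auto intro!: insert.prems)
  ultimately show ?case
    by (simp add: subset_expectation_insert[OF insert.hyps assms(2,3)] d)
qed

text \<open>Given that \<open>U\<close> is selected, the rest of the random subset is a random subset of \<open>V - U\<close>.\<close>

lemma subset_expectation_superset:
  assumes "finite V" "U \<subseteq> V" "0 \<le> p" "p \<le> 1"
  shows "subset_expectation V p (\<lambda>F. of_bool (U \<subseteq> F) * h (F - U))
    = p ^ card U * subset_expectation (V - U) p h"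
proof -
  have "finite U" using assms finite_subset by auto
  from this assms(1,2) show ?thesis
  proof (induction U arbitrary: V h rule: finite_induct)
    case empty
    then show ?case by simp
  next
    case (insert x U)
    define W where "W = V - {x}"
    have V: "V = insert x W" "x \<notin> W" "finite W" "U \<subseteq> W"
      using insert unfolding W_def by auto
    have "subset_expectation V p (\<lambda>F. of_bool (insert x U \<subseteq> F) * h (F - insert x U))
       = p * subset_expectation W p (\<lambda>F. of_bool (insert x U \<subseteq> insert x F) * h (insert x F - insert x U))
         + (1 - p) * subset_expectation W p (\<lambda>F. of_bool (insert x U \<subseteq> F) * h (F - insert x U))"
      unfolding V(1) by (rule subset_expectation_insert) (use V assms in auto)
    also have "subset_expectation W p (\<lambda>F. of_bool (insert x U \<subseteq> F) * h (F - insert x U))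
        = subset_expectation W p (\<lambda>F. 0)"
      by (rule subset_expectation_cong) (use V in auto)
    also have "subset_expectation W p
          (\<lambda>F. of_bool (insert x U \<subseteq> insert x F) * h (insert x F - insert x U))
        = subset_expectation W p (\<lambda>F. of_bool (U \<subseteq> F) * h (F - U))"
    proof (rule subset_expectation_cong)
      fix F assume "F \<subseteq> W"
      then have "insert x F - insert x U = F - U" "insert x U \<subseteq> insert x F \<longleftrightarrow> U \<subseteq> F"
        using V insert.hyps by auto
      then show "of_bool (insert x U \<subseteq> insert x F) * h (insert x F - insert x U)
          = of_bool (U \<subseteq> F) * h (F - U)" by simp
    qed
    also have "\<dots> = p ^ card U * subset_expectation (W - U) p h"
      by (rule insert.IH) (use V in auto)
    also have "W - U = V - insert x U" unfolding W_def by auto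
    finally show ?case using insert.hyps by simp
  qed
qed

lemma prob_superset:
  assumes "finite V" "U \<subseteq> V" "0 \<le> p" "p \<le> 1"
  shows "measure_pmf.prob (random_subset V p) {F. U \<subseteq> F} = p ^ card U"
proof -
  have "measure_pmf.prob (random_subset V p) {F. U \<subseteq> F}
      = subset_expectation V p (indicator {F. U \<subseteq> F})" by simp
  also have "\<dots> = subset_expectation V p (\<lambda>F. of_bool (U \<subseteq> F) * 1)"
    by (rule subset_expectation_cong) (simp add: indicator_def)
  also have "\<dots> = p ^ card U"
    by (subst subset_expectation_superset[OF assms]) simp
  finally show ?thesis .
qed

text \<open>Avoiding one forbidden set is a decreasing event, so by the Harris inequality avoiding several of
them is at least as likely as it would be under independence.\<close>

lemma subset_expectation_forbidden:
  assumes "finite V" "finite I" "0 \<le> p" "p \<le> 1" "\<And>i. i \<in> I \<Longrightarrow> c i \<subseteq> V"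
  shows "(\<Prod>i\<in>I. 1 - p ^ card (c i)) \<le> subset_expectation V p (\<lambda>F. of_bool (\<forall>i\<in>I. \<not> c i \<subseteq> F))"
  using assms(2,5)
proof (induction I rule: finite_induct)
  case empty
  then show ?case by simp
next
  case (insert i I)
  let ?E = "subset_expectation V p"
  have "?E (\<lambda>F. of_bool (\<not> c i \<subseteq> F)) = ?E (\<lambda>F. 1 - of_bool (c i \<subseteq> F) * 1)"
    by (rule subset_expectation_cong) simp
  also have "\<dots> = 1 - p ^ card (c i) * 1"
    using assms insert.prems by (subst Bochner_Integration.integral_diff)
      (auto simp: subset_expectation_superset[where h="\<lambda>_. 1", simplified])
  finally have 1: "?E (\<lambda>F. of_bool (\<not> c i \<subseteq> F)) = 1 - p ^ card (c i)" by simp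
  have "(\<Prod>i\<in>insert i I. 1 - p ^ card (c i)) = (1 - p ^ card (c i)) * (\<Prod>i\<in>I. 1 - p ^ card (c i))"
    using insert by simp
  also have "\<dots> \<le> ?E (\<lambda>F. of_bool (\<not> c i \<subseteq> F)) * ?E (\<lambda>F. of_bool (\<forall>i\<in>I. \<not> c i \<subseteq> F))"
    unfolding 1 using assms(3,4) by (intro mult_left_mono insert) (auto intro: insert power_le_one)
  also have "\<dots> \<le> ?E (\<lambda>F. of_bool (\<not> c i \<subseteq> F) * of_bool (\<forall>i\<in>I. \<not> c i \<subseteq> F))"
    by (rule harris_inequality) (use assms in \<open>auto simp: of_bool_def dest: subset_trans\<close>)
  also have "\<dots> = ?E (\<lambda>F. of_bool (\<forall>i\<in>insert i I. \<not> c i \<subseteq> F))"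
    by (rule subset_expectation_cong) auto
  finally show ?case .
qed

section \<open>Total variation distance and Poisson variables\<close>

lemma d_TV_upper: "\<bar>measure_pmf.prob P S - measure_pmf.prob Q S\<bar> \<le> d_TV P Q"
proof -
  have "\<bar>measure_pmf.prob P T - measure_pmf.prob Q T\<bar> \<le> 1" for T
    using measure_pmf.prob_le_1[of P T] measure_pmf.prob_le_1[of Q T]
      measure_nonneg[of P T] measure_nonneg[of Q T] by linarith
  then have "bdd_above (range (\<lambda>T. \<bar>measure_pmf.prob P T - measure_pmf.prob Q T\<bar>))"
    by (intro bdd_aboveI[of _ 1]) auto
  then show ?thesis
    unfolding d_TV_def by (rule cSUP_upper[rotated]) simp
qed

lemma d_TV_nonneg: "0 \<le> d_TV P Q"
  using d_TV_upper[of P "{}" Q] by simp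

lemma d_TV_map_pmf_le: "d_TV (map_pmf f P) (map_pmf f Q) \<le> d_TV P Q"
  unfolding d_TV_def[of "map_pmf f P"] by (rule cSUP_least) (simp_all add: d_TV_upper)

lemma d_TV_le_one_sided:
  assumes "\<And>S. measure_pmf.prob Q S \<le> measure_pmf.prob P S + c"
  shows "d_TV P Q \<le> c"
  unfolding d_TV_def
proof (rule cSUP_least)
  fix S
  have "measure_pmf.prob M (- S) = 1 - measure_pmf.prob M S" for M :: "'a pmf"
    using measure_pmf.prob_compl[of S M] by (simp add: Compl_eq_Diff_UNIV)
  then show "\<bar>measure_pmf.prob P S - measure_pmf.prob Q S\<bar> \<le> c"
    using assms[of S] assms[of "- S"] by simp
qed simp

text \<open>If \<open>P\<close> has at least the fraction \<open>1 - h\<close> of the mass of \<open>Q\<close> at every point, then \<open>P\<close> falls short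
of \<open>Q\<close> on any event by at most the \<open>Q\<close>-mean of \<open>h\<close>. An excess on an event is a shortfall on its
complement, which is why the one-sided comparison suffices.\<close>

lemma d_TV_le_density:
  fixes h :: "'a \<Rightarrow> real"
  assumes h: "integrable (measure_pmf Q) h" "\<And>x. 0 \<le> h x"
    and dens: "\<And>x. pmf Q x \<le> pmf P x + pmf Q x * h x"
  shows "d_TV P Q \<le> measure_pmf.expectation Q h"
proof (rule d_TV_le_one_sided)
  fix S
  let ?C = "count_space UNIV :: 'a measure"
  have em: "emeasure (measure_pmf M) S = (\<integral>\<^sup>+x. ennreal (pmf M x) * indicator S x \<partial>?C)"
    for M :: "'a pmf"
    by (simp add: nn_integral_measure_pmf[symmetric])
  have "ennreal (pmf Q x) \<le> ennreal (pmf P x) + ennreal (pmf Q x) * ennreal (h x)" for x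
    using dens[of x] h(2)[of x]
    by (simp flip: ennreal_plus ennreal_mult add: ennreal_le_iff)
  then have "emeasure (measure_pmf Q) S
      \<le> (\<integral>\<^sup>+x. ennreal (pmf P x) * indicator S x + ennreal (pmf Q x) * ennreal (h x) \<partial>?C)"
    unfolding em by (intro nn_integral_mono) (auto simp: indicator_def)
  also have "\<dots> = emeasure (measure_pmf P) S + (\<integral>\<^sup>+x. ennreal (h x) \<partial>measure_pmf Q)"
    unfolding em by (subst nn_integral_add) (simp_all add: nn_integral_measure_pmf)
  also have "\<dots> = ennreal (measure_pmf.prob P S + measure_pmf.expectation Q h)"
    using h by (simp add: measure_pmf.emeasure_eq_measure nn_integral_eq_integral)
  finally show "measure_pmf.prob Q S \<le> measure_pmf.prob P S + measure_pmf.expectation Q h"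
    using h(2)
    by (subst (asm) measure_pmf.emeasure_eq_measure) (simp add: ennreal_le_iff del: ennreal_plus)
qed

text \<open>Useful when both laws are nearly concentrated on the same point \<open>x\<close>.\<close>

lemma d_TV_le_common_atom:
  "d_TV P Q \<le> (1 - pmf P x) + (1 - pmf Q x)"
proof (rule d_TV_le_one_sided)
  fix S
  show "measure_pmf.prob Q S \<le> measure_pmf.prob P S + ((1 - pmf P x) + (1 - pmf Q x))"
  proof (cases "x \<in> S")
    case True
    then have "pmf P x \<le> measure_pmf.prob P S"
      by (simp add: measure_pmf_single[symmetric] measure_pmf.finite_measure_mono)
    moreover have "measure_pmf.prob Q S \<le> 1" "pmf Q x \<le> 1" by (simp_all add: pmf_le_1)
    ultimately show ?thesis by linarith
  next
    case False
    then have "measure_pmf.prob Q S \<le> measure_pmf.prob Q (- {x})"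
      by (intro measure_pmf.finite_measure_mono) auto
    also have "\<dots> = 1 - pmf Q x"
      using measure_pmf.prob_compl[of "{x}" Q] by (simp add: measure_pmf_single Compl_eq_Diff_UNIV)
    finally show ?thesis using pmf_le_1[of P x] measure_nonneg[of P S] by linarith
  qed
qed

lemma pmf_Po: "0 \<le> r \<Longrightarrow> pmf (Po r) x = r ^ x / fact x * exp (- r)"
  by (cases "r = 0") (auto simp: Po_def pmf_return indicator_def power_0_left)

lemma Po_convolution:
  assumes "0 \<le> r" "0 \<le> s"
  shows "Po s \<bind> (\<lambda>y. Po r \<bind> (\<lambda>z. return_pmf (z + y))) = Po (r + s)"
proof (rule pmf_eqI)
  fix n
  have "Po s \<bind> (\<lambda>y. Po r \<bind> (\<lambda>z. return_pmf (z + y)))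
      = map_pmf (\<lambda>(y, z). z + y) (pair_pmf (Po s) (Po r))"
    by (simp add: pair_pmf_def map_bind_pmf)
  then have "pmf (Po s \<bind> (\<lambda>y. Po r \<bind> (\<lambda>z. return_pmf (z + y)))) n
      = measure_pmf.prob (pair_pmf (Po s) (Po r)) ((\<lambda>(y, z). z + y) -` {n})"
    by (simp add: pmf_map)
  also have "(\<lambda>(y, z). z + y) -` {n} = (\<lambda>i. (n - i, i)) ` {..n}"
    by (auto simp: image_iff)
  also have "measure_pmf.prob (pair_pmf (Po s) (Po r)) \<dots>
      = (\<Sum>i\<le>n. pmf (Po s) (n - i) * pmf (Po r) i)"
    by (subst measure_measure_pmf_finite) (auto simp: sum.reindex inj_on_def pmf_pair)
  also have "\<dots> = (\<Sum>i\<le>n. real (n choose i) * r ^ i * s ^ (n - i)) / fact n * exp (- (r + s))"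
    unfolding sum_divide_distrib sum_distrib_right minus_add_distrib exp_add
    by (intro sum.cong refl) (use assms in \<open>simp add: pmf_Po binomial_fact mult_ac\<close>)
  also have "\<dots> = pmf (Po (r + s)) n"
    using assms by (simp add: pmf_Po binomial_ring)
  finally show "pmf (Po s \<bind> (\<lambda>y. Po r \<bind> (\<lambda>z. return_pmf (z + y)))) n = pmf (Po (r + s)) n" .
qed

lemma Po_tail:
  assumes "0 \<le> r"
  shows "measure_pmf.prob (Po r) {1..} \<le> r" "measure_pmf.prob (Po r) {2..} \<le> r\<^sup>2"
proof -
  have e: "1 - r \<le> exp (- r)" using exp_ge_add_one_self[of "-r"] by simp
  have "{1::nat..} = UNIV - {0}" by auto
  then have "measure_pmf.prob (Po r) {1..} = 1 - measure_pmf.prob (Po r) {0}"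
    using measure_pmf.prob_compl[of "{0}" "Po r"] by simp
  then show "measure_pmf.prob (Po r) {1..} \<le> r"
    using e assms by (simp add: measure_pmf_single pmf_Po)
  have "{2::nat..} = UNIV - {0, 1}" by auto
  then have "measure_pmf.prob (Po r) {2..} = 1 - measure_pmf.prob (Po r) {0, 1}"
    using measure_pmf.prob_compl[of "{0, 1}" "Po r"] by simp
  also have "\<dots> = 1 - exp (- r) * (1 + r)"
    using assms by (simp add: measure_measure_pmf_finite pmf_Po algebra_simps)
  also have "\<dots> \<le> 1 - (1 - r) * (1 + r)"
    using e assms by (intro diff_left_mono mult_right_mono) auto
  also have "\<dots> = r\<^sup>2" by (simp add: algebra_simps power2_eq_square)
  finally show "measure_pmf.prob (Po r) {2..} \<le> r\<^sup>2" .
qed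

text \<open>Superposition of Poisson variables: in a Poisson process on \<open>E\<close> with the same intensity \<open>q\<close> at every
point, the total multiplicities of the classes of \<open>c\<close> are independent and Poisson distributed with
means proportional to the class sizes. Classes without members receive the point mass at 0.\<close>

lemma map_pmf_fibre_sums_Po:
  assumes "finite E" "finite J" "c ` E \<subseteq> J" "0 \<le> q"
  shows "map_pmf (\<lambda>f j. \<Sum>e | e \<in> E \<and> c e = j. f e) (Pi_pmf E 0 (\<lambda>_. Po q))
    = Pi_pmf J 0 (\<lambda>j. Po (real (card {e \<in> E. c e = j}) * q))"
  using assms(1,3)
proof (induction E rule: finite_induct)
  case empty
  then show ?case by (simp add: Po_def assms(2))
next
  case (insert e E)
  define i where "i = c e"
  define n where "n E j = real (card {e \<in> E. c e = j})" for E j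
  define J' where "J' = J - {i}"
  have J: "J = insert i J'" "i \<notin> J'" "finite J'"
    using insert.prems assms(2) by (auto simp: J'_def i_def)
  have fibre: "{e' \<in> insert e E. c e' = j} = (if j = i then insert e {e' \<in> E. c e' = j} else {e' \<in> E. c e' = j})"
    for j by (auto simp: i_def)
  have n_i: "n (insert e E) i * q = n E i * q + q"
    unfolding n_def fibre using insert.hyps by (simp add: distrib_right)
  have n_other: "n (insert e E) j = n E j" if "j \<noteq> i" for j
    unfolding n_def fibre using that by simp
  define G :: "'a set \<Rightarrow> ('a \<Rightarrow> nat) \<Rightarrow> 'b \<Rightarrow> nat" where
    "G E f j = (\<Sum>e | e \<in> E \<and> c e = j. f e)" for E f j
  have upd: "G (insert e E) (f(e := y)) = (G E f)(i := G E f i + y)" for f y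
  proof
    fix j
    have "(\<Sum>e' | e' \<in> E \<and> c e' = j. (f(e := y)) e') = (\<Sum>e' | e' \<in> E \<and> c e' = j. f e')"
      using insert.hyps by (intro sum.cong) auto
    then show "G (insert e E) (f(e := y)) j = ((G E f)(i := G E f i + y)) j"
      unfolding fun_upd_apply[of "G E f"] G_def fibre
      using insert.hyps by (cases "j = i") simp_all
  qed
  have "map_pmf (G (insert e E)) (Pi_pmf (insert e E) 0 (\<lambda>_. Po q))
      = Po q \<bind> (\<lambda>y. Pi_pmf E 0 (\<lambda>_. Po q) \<bind> (\<lambda>f. return_pmf ((G E f)(i := G E f i + y))))"
    by (simp only: Pi_pmf_insert'[OF insert.hyps] map_bind_pmf map_return_pmf upd)
  also have "\<dots> = Po q \<bind> (\<lambda>y. map_pmf (\<lambda>g. g(i := g i + y))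
      (map_pmf (G E) (Pi_pmf E 0 (\<lambda>_. Po q))))"
    by (simp only: map_pmf_def bind_assoc_pmf bind_return_pmf)
  also have "\<dots> = Po q \<bind> (\<lambda>y. map_pmf (\<lambda>g. g(i := g i + y)) (Pi_pmf J 0 (\<lambda>j. Po (n E j * q))))"
    using insert.IH insert.prems by (simp add: n_def G_def[abs_def])
  also have "\<dots> = (Po q \<bind> (\<lambda>y. Po (n E i * q) \<bind> (\<lambda>z. return_pmf (z + y)))) \<bind>
      (\<lambda>w. Pi_pmf J' 0 (\<lambda>j. Po (n E j * q)) \<bind> (\<lambda>g. return_pmf (g(i := w))))"
    unfolding J(1) Pi_pmf_insert'[OF J(3,2)]
    by (simp only: map_pmf_def bind_assoc_pmf bind_return_pmf fun_upd_upd fun_upd_same)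
  also have "Po q \<bind> (\<lambda>y. Po (n E i * q) \<bind> (\<lambda>z. return_pmf (z + y))) = Po (n (insert e E) i * q)"
    unfolding n_i using assms(4) by (intro Po_convolution) (simp_all add: n_def)
  also have "Pi_pmf J' 0 (\<lambda>j. Po (n E j * q)) = Pi_pmf J' 0 (\<lambda>j. Po (n (insert e E) j * q))"
    using J(2) by (intro Pi_pmf_cong refl) (metis n_other)
  also have "Po (n (insert e E) i * q) \<bind>
      (\<lambda>w. Pi_pmf J' 0 (\<lambda>j. Po (n (insert e E) j * q)) \<bind> (\<lambda>g. return_pmf (g(i := w))))
      = Pi_pmf J 0 (\<lambda>j. Po (n (insert e E) j * q))"
    unfolding J(1) Pi_pmf_insert'[OF J(3,2)] ..
  finally show ?case by (simp add: n_def G_def[abs_def])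
qed

lemma prob_Pi_pmf_two_components:
  assumes "finite E" "e \<in> E" "e' \<in> E" "e \<noteq> e'"
  shows "measure_pmf.prob (Pi_pmf E d R) {f. f e \<in> B \<and> f e' \<in> B'}
    = measure_pmf.prob (R e) B * measure_pmf.prob (R e') B'"
proof -
  define C where "C x = (if x = e then B else if x = e' then B' else UNIV)" for x
  have "{f. f e \<in> B \<and> f e' \<in> B'} = Pi E C"
    using assms by (auto simp: C_def Pi_def)
  then have "measure_pmf.prob (Pi_pmf E d R) {f. f e \<in> B \<and> f e' \<in> B'}
      = (\<Prod>x\<in>E. measure_pmf.prob (R x) (C x))"
    by (simp add: measure_Pi_pmf_Pi[OF assms(1)])
  also have "\<dots> = (\<Prod>x\<in>{e, e'}. measure_pmf.prob (R x) (C x))"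
    using assms by (intro prod.mono_neutral_right) (auto simp: C_def)
  finally show ?thesis using assms(4) by (simp add: C_def)
qed

lemma prob_Pi_pmf_component:
  assumes "finite E" "e \<in> E"
  shows "measure_pmf.prob (Pi_pmf E d R) {f. f e \<in> B} = measure_pmf.prob (R e) B"
proof -
  have "{f. f e \<in> B} = (\<lambda>f. f e) -` B" by auto
  then show ?thesis
    using Pi_pmf_component[OF assms(1), of e d R] assms(2) by (simp flip: measure_map_pmf)
qed

section \<open>Induced edges of a random vertex set\<close>

lemma card_nsets2: "e \<in> [V]\<^bsup>2\<^esup> \<Longrightarrow> card e = 2" "e \<in> [V]\<^bsup>2\<^esup> \<Longrightarrow> finite e"
  "e \<in> [V]\<^bsup>2\<^esup> \<Longrightarrow> e \<subseteq> V"
  by (auto simp: nsets_def)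

text \<open>The assumption on \<open>M\<close> covers edges \<open>g\<close> of \<open>M\<close> itself, so the members of \<open>M\<close> are pairwise disjoint;
for the other edges it says that \<open>M\<close> is an induced matching. Once the endpoints of \<open>M\<close> are
selected, an edge \<open>g\<close> outside \<open>M\<close> lies inside the random subset iff the part of \<open>g\<close> away from these
endpoints does. That part has one element if \<open>g\<close> touches \<open>M\<close>, which happens for at most \<open>2 D |M|\<close>
edges, and two elements otherwise.\<close>

lemma prob_induced_matching_ge:
  fixes E :: "'a set set" and p :: real
  assumes V: "finite V" and E: "E \<subseteq> [V]\<^bsup>2\<^esup>" and p: "0 \<le> p" "p \<le> 1"
    and deg: "\<And>v. v \<in> V \<Longrightarrow> card {e \<in> E. v \<in> e} \<le> D"
    and M: "M \<subseteq> E"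
    and induced: "\<And>g e e'. g \<in> E \<Longrightarrow> e \<in> M \<Longrightarrow> e' \<in> M \<Longrightarrow> g \<inter> e \<noteq> {} \<Longrightarrow> g \<inter> e' \<noteq> {} \<Longrightarrow> e = e'"
  shows "(p\<^sup>2) ^ card M * (1 - p\<^sup>2) ^ card E * (1 - p) ^ (2 * D * card M)
    \<le> measure_pmf.prob (random_subset V p) {F. {e \<in> E. e \<subseteq> F} = M}"
proof -
  define U where "U = \<Union>M"
  have fin: "finite E" "finite M"
    using V E M finite_imp_finite_nsets finite_subset by metis+
  have two: "card e = 2" "finite e" "e \<subseteq> V" if "e \<in> E" for e
    using that E card_nsets2 by blast+
  have U: "U \<subseteq> V" "finite U"
    using two(3) M V by (auto simp: U_def intro: finite_subset)
  have "pairwise disjnt M"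
    using induced M unfolding pairwise_def disjnt_def by blast
  then have "card U = (\<Sum>e\<in>M. card e)"
    unfolding U_def using two M by (intro card_Union_disjoint) auto
  also have "\<dots> = 2 * card M"
    using two M by (subst sum.cong[OF refl, of M _ "\<lambda>_. 2"]) auto
  finally have card_U: "card U = 2 * card M" .
  \<comment> \<open>An edge with both endpoints in U touches only one member of M, hence coincides with it.\<close>
  have outside: "g - U \<noteq> {}" if g: "g \<in> E - M" for g
  proof
    assume "g - U = {}"
    moreover from g obtain u v where uv: "g = {u, v}"
      using two(1)[of g] by (auto simp: card_2_iff)
    ultimately obtain e e' where e: "e \<in> M" "u \<in> e" "e' \<in> M" "v \<in> e'"
      by (auto simp: U_def)
    with induced[of g e e'] g uv have "e = e'" by auto
    with e uv have "g \<subseteq> e" by auto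
    with two[of g] two[of e] g e M have "g = e" by (metis Diff_iff card_subset_eq subsetD)
    with g e show False by simp
  qed
  define Q where "Q F \<longleftrightarrow> (\<forall>g\<in>E - M. \<not> g - U \<subseteq> F)" for F
  have touching: "card {g \<in> E - M. g \<inter> U \<noteq> {}} \<le> 2 * D * card M"
  proof -
    have "{g \<in> E - M. g \<inter> U \<noteq> {}} \<subseteq> (\<Union>u\<in>U. {g \<in> E. u \<in> g})" by auto
    then have "card {g \<in> E - M. g \<inter> U \<noteq> {}} \<le> card (\<Union>u\<in>U. {g \<in> E. u \<in> g})"
      using fin U by (intro card_mono) auto
    also have "\<dots> \<le> (\<Sum>u\<in>U. card {g \<in> E. u \<in> g})"
      by (rule card_UN_le[OF U(2)])
    also have "\<dots> \<le> (\<Sum>u\<in>U. D)"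
      using deg U by (intro sum_mono) auto
    finally show ?thesis by (simp add: card_U ac_simps)
  qed
  have p2: "p\<^sup>2 \<le> 1" using p by (simp add: power_le_one)
  have "(1 - p\<^sup>2) ^ card E * (1 - p) ^ (2 * D * card M)
      \<le> (1 - p\<^sup>2) ^ card {g \<in> E - M. g \<inter> U = {}} * (1 - p) ^ card {g \<in> E - M. g \<inter> U \<noteq> {}}"
    using p p2 touching fin by (intro mult_mono power_decreasing card_mono) auto
  also have "\<dots> = (\<Prod>g\<in>E - M. if g \<inter> U = {} then 1 - p\<^sup>2 else 1 - p)"
  proof -
    have "(E - M) \<inter> {g. g \<inter> U = {}} = {g \<in> E - M. g \<inter> U = {}}"
      "(E - M) \<inter> - {g. g \<inter> U = {}} = {g \<in> E - M. g \<inter> U \<noteq> {}}" by auto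
    then show ?thesis using fin by (simp add: prod.If_cases)
  qed
  also have "\<dots> \<le> (\<Prod>g\<in>E - M. 1 - p ^ card (g - U))"
  proof (intro prod_mono conjI)
    fix g assume g: "g \<in> E - M"
    show "0 \<le> (if g \<inter> U = {} then 1 - p\<^sup>2 else 1 - p)" using p p2 by simp
    have "p ^ card (g - U) \<le> p ^ 1"
      using outside[OF g] two[of g] g p by (intro power_decreasing) (auto simp: Suc_le_eq card_gt_0_iff)
    moreover have "card (g - U) = 2" if "g \<inter> U = {}"
      using that two[of g] g by (simp add: Diff_triv)
    ultimately show "(if g \<inter> U = {} then 1 - p\<^sup>2 else 1 - p) \<le> 1 - p ^ card (g - U)" by simp
  qed
  also have "\<dots> \<le> subset_expectation (V - U) p (\<lambda>F. of_bool (Q F))"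
    unfolding Q_def using V fin p two by (intro subset_expectation_forbidden) auto
  finally have "p ^ card U * ((1 - p\<^sup>2) ^ card E * (1 - p) ^ (2 * D * card M))
      \<le> p ^ card U * subset_expectation (V - U) p (\<lambda>F. of_bool (Q F))"
    using p by (intro mult_left_mono) auto
  also have "\<dots> = subset_expectation V p (\<lambda>F. of_bool (U \<subseteq> F) * of_bool (Q (F - U)))"
    by (rule subset_expectation_superset[OF V U(1) p, symmetric])
  also have "\<dots> \<le> subset_expectation V p (indicator {F. {e \<in> E. e \<subseteq> F} = M})"
  proof (rule subset_expectation_mono[OF V])
    fix F
    have "{e \<in> E. e \<subseteq> F} = M" if "U \<subseteq> F" "Q (F - U)"
    proof (intro equalityI subsetI)
      fix e assume "e \<in> M"
      then show "e \<in> {e \<in> E. e \<subseteq> F}" using M that by (auto simp: U_def)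
    next
      fix e assume "e \<in> {e \<in> E. e \<subseteq> F}"
      then show "e \<in> M" using that(2) unfolding Q_def by blast
    qed
    then show "of_bool (U \<subseteq> F) * of_bool (Q (F - U)) \<le> (indicator {F. {e \<in> E. e \<subseteq> F} = M} F :: real)"
      by (auto simp: indicator_def)
  qed
  finally show ?thesis
    by (simp add: card_U power_mult mult.assoc)
qed

text \<open>The values are natural numbers so that these indicators and the multiplicities of a Poisson process
on the edges live on the same space.\<close>

definition edge_indicator :: "'a set set \<Rightarrow> 'a set \<Rightarrow> 'a set \<Rightarrow> nat" where
  "edge_indicator E F e = of_bool (e \<in> E \<and> e \<subseteq> F)"

lemma pmf_Po_process_indicator:
  assumes "finite E" "M \<subseteq> E" "0 \<le> q"
  shows "pmf (Pi_pmf E 0 (\<lambda>_. Po q)) (\<lambda>e. of_bool (e \<in> M)) = q ^ card M * exp (- q) ^ card E"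
proof -
  have "pmf (Pi_pmf E 0 (\<lambda>_. Po q)) (\<lambda>e. of_bool (e \<in> M))
      = (\<Prod>e\<in>E. (if e \<in> M then q else 1) * exp (- q))"
    using assms by (subst pmf_Pi') (auto simp: pmf_Po intro!: prod.cong)
  also have "\<dots> = q ^ card M * exp (- q) ^ card E"
    using assms by (simp add: prod.distrib prod.If_cases Int_absorb1)
  finally show ?thesis .
qed

text \<open>Passing from Bernoulli to Poisson empty-set probabilities costs a relative error of \<open>q\<^sup>2\<close> per edge,
since \<open>(1 - q) exp q \<ge> (1 - q) (1 + q)\<close>.\<close>

lemma one_minus_power_ge_exp:
  assumes "0 \<le> q" "q \<le> (1 :: real)"
  shows "exp (- q) ^ n * (1 - real n * q\<^sup>2) \<le> (1 - q) ^ n"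
proof -
  have q2: "0 \<le> 1 - q\<^sup>2" using assms by (simp add: power_le_one)
  have "(1 - q) * (1 + q) \<le> (1 - q) * exp q"
    using assms by (intro mult_left_mono exp_ge_add_one_self) auto
  then have "exp (- q) * (1 - q\<^sup>2) \<le> exp (- q) * ((1 - q) * exp q)"
    by (intro mult_left_mono) (auto simp: algebra_simps power2_eq_square)
  also have "\<dots> = 1 - q" by (simp add: exp_minus)
  finally have *: "exp (- q) * (1 - q\<^sup>2) \<le> 1 - q" .
  have "1 - real n * q\<^sup>2 \<le> (1 - q\<^sup>2) ^ n"
    using Bernoulli_inequality[of "- (q\<^sup>2)" n] q2 by simp
  then have "exp (- q) ^ n * (1 - real n * q\<^sup>2) \<le> exp (- q) ^ n * (1 - q\<^sup>2) ^ n"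
    by (intro mult_left_mono) auto
  also have "\<dots> = (exp (- q) * (1 - q\<^sup>2)) ^ n" by (simp add: power_mult_distrib)
  also have "\<dots> \<le> (1 - q) ^ n" using * q2 by (intro power_mono) auto
  finally show ?thesis .
qed

text \<open>Two edges are linked when some edge \<open>g\<close> touches both. Edges that share a vertex are linked, with \<open>g\<close>
one of the two; otherwise \<open>g\<close> joins them. An edge touches at most \<open>2 D\<close> edges, and each of those
touches at most \<open>2 D\<close> edges.\<close>

lemma card_linked_pairs_le:
  fixes E :: "'a set set"
  assumes V: "finite V" and E: "E \<subseteq> [V]\<^bsup>2\<^esup>"
    and deg: "\<And>v. v \<in> V \<Longrightarrow> card {e \<in> E. v \<in> e} \<le> D"
  shows "card {(e, e'). e \<in> E \<and> e' \<in> E \<and> e \<noteq> e' \<and> (\<exists>g\<in>E. g \<inter> e \<noteq> {} \<and> g \<inter> e' \<noteq> {})}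
    \<le> 4 * D\<^sup>2 * card E" (is "card ?B \<le> _")
proof -
  have finE: "finite E" by (rule finite_subset[OF E finite_imp_finite_nsets[OF V]])
  have two: "card e = 2" "finite e" "e \<subseteq> V" if "e \<in> E" for e
    using that E card_nsets2 by blast+
  define N where "N e = {e' \<in> E. e \<inter> e' \<noteq> {}}" for e
  have N: "card (N e) \<le> 2 * D" "finite (N e)" if "e \<in> E" for e
  proof -
    have "N e = (\<Union>u\<in>e. {e' \<in> E. u \<in> e'})" by (auto simp: N_def)
    then have "card (N e) \<le> (\<Sum>u\<in>e. card {e' \<in> E. u \<in> e'})"
      using card_UN_le[OF two(2)[OF that]] by metis
    also have "\<dots> \<le> (\<Sum>u\<in>e. D)" using two(3)[OF that] deg by (intro sum_mono) auto
    finally show "card (N e) \<le> 2 * D" using two(1)[OF that] by simp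
    show "finite (N e)" using finE by (simp add: N_def)
  qed
  have N2: "card (\<Union>g\<in>N e. N g) \<le> 4 * D\<^sup>2" if "e \<in> E" for e
  proof -
    have "card (\<Union>g\<in>N e. N g) \<le> (\<Sum>g\<in>N e. card (N g))" by (rule card_UN_le[OF N(2)[OF that]])
    also have "\<dots> \<le> (\<Sum>g\<in>N e. 2 * D)" using N by (intro sum_mono) (auto simp: N_def)
    also have "\<dots> \<le> 2 * D * (2 * D)" using N(1)[OF that] by simp
    finally show ?thesis by (simp add: power2_eq_square)
  qed
  have "?B \<subseteq> (SIGMA e:E. \<Union>g\<in>N e. N g)" by (auto simp: N_def)
  then have "card ?B \<le> card (SIGMA e:E. \<Union>g\<in>N e. N g)"
    using finE N by (intro card_mono) (auto simp: N_def)
  also have "\<dots> = (\<Sum>e\<in>E. card (\<Union>g\<in>N e. N g))"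
    using finE by (intro card_SigmaI) (auto simp: N_def)
  also have "\<dots> \<le> (\<Sum>e\<in>E. 4 * D\<^sup>2)" by (intro sum_mono N2)
  finally show ?thesis by (simp add: ac_simps)
qed

text \<open>The term \<open>2 p^4\<close> collects the replacement of Bernoulli by Poisson variables and the multiplicities
above 1, the term \<open>2 D p^3\<close> the edges that touch a selected one, and \<open>4 D\<^sup>2 p^4\<close> the linked pairs.\<close>

lemma d_TV_induced_edges_Po_process_le:
  fixes E :: "'a set set" and p :: real
  assumes V: "finite V" and E: "E \<subseteq> [V]\<^bsup>2\<^esup>" and p: "0 \<le> p" "p \<le> 1"
    and deg: "\<And>v. v \<in> V \<Longrightarrow> card {e \<in> E. v \<in> e} \<le> D"
  shows "d_TV (map_pmf (edge_indicator E) (random_subset V p)) (Pi_pmf E 0 (\<lambda>_. Po (p\<^sup>2)))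
    \<le> card E * (2 * p ^ 4 + 2 * real D * p ^ 3 + 4 * (real D)\<^sup>2 * p ^ 4)"
proof -
  have finE: "finite E" by (rule finite_subset[OF E finite_imp_finite_nsets[OF V]])
  define q where "q = p\<^sup>2"
  have q: "0 \<le> q" "q \<le> 1" using p by (auto simp: q_def power_le_one)
  define P where "P = map_pmf (edge_indicator E) (random_subset V p)"
  define R where "R = Pi_pmf E 0 (\<lambda>_. Po q)"
  define B where "B = {(e, e'). e \<in> E \<and> e' \<in> E \<and> e \<noteq> e' \<and> (\<exists>g\<in>E. g \<inter> e \<noteq> {} \<and> g \<inter> e' \<noteq> {})}"
  have finB: "finite B"
    by (rule finite_subset[of _ "E \<times> E"]) (use finE in \<open>auto simp: B_def\<close>)
  \<comment> \<open>The relative shortfall of P: the first bracket handles indicators of unlinked edge sets, the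
    second is at least 1 at every other configuration supported on E.\<close>
  define h :: "('a set \<Rightarrow> nat) \<Rightarrow> real" where
    "h f = (card E * q\<^sup>2 + (\<Sum>e\<in>E. 2 * real D * p * indicator {f. f e \<in> {1..}} f))
      + ((\<Sum>e\<in>E. indicator {f. f e \<in> {2..}} f)
      + (\<Sum>(e, e')\<in>B. indicator {f. f e \<in> {1..} \<and> f e' \<in> {1..}} f))" for f
  have nonneg: "0 \<le> card E * q\<^sup>2" "0 \<le> (\<Sum>e\<in>E. 2 * real D * p * indicator {f. f e \<in> {1..}} f)"
    "0 \<le> (\<Sum>e\<in>E. indicator {f. f e \<in> {2..}} f :: real)"
    "0 \<le> (\<Sum>(e, e')\<in>B. indicator {f. f e \<in> {1..} \<and> f e' \<in> {1..}} f :: real)"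
    for f :: "'a set \<Rightarrow> nat"
    using p by (auto intro!: sum_nonneg)
  have dens: "pmf R f \<le> pmf P f + pmf R f * h f" for f
  proof (cases "pmf R f = 0 \<or> h f \<ge> 1")
    case True
    then show ?thesis
      using mult_left_mono[of 1 "h f" "pmf R f"] by (auto intro: add_increasing)
  next
    case False
    then have small: "h f < 1" by simp
    have outside: "f e = 0" if "e \<notin> E" for e
      using False that by (auto simp: R_def pmf_Pi[OF finE] split: if_splits)
    have le1: "f e \<le> 1" if "e \<in> E" for e
    proof (rule ccontr)
      assume "\<not> f e \<le> 1"
      then have "1 \<le> (indicator {f. f e \<in> {2..}} f :: real)" by (simp add: indicator_def)
      also have "\<dots> \<le> (\<Sum>e\<in>E. indicator {f. f e \<in> {2..}} f)"
        using that finE by (intro member_le_sum) auto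
      finally show False using small nonneg(1) nonneg(2,4)[of f] unfolding h_def by linarith
    qed
    have unlinked: "f e = 0 \<or> f e' = 0" if "(e, e') \<in> B" for e e'
    proof (rule ccontr)
      assume "\<not> (f e = 0 \<or> f e' = 0)"
      then have "1 \<le> (case (e, e') of (e, e') \<Rightarrow> (indicator {f. f e \<in> {1..} \<and> f e' \<in> {1..}} f :: real))"
        by (simp add: indicator_def)
      also have "\<dots> \<le> (\<Sum>(e, e')\<in>B. indicator {f. f e \<in> {1..} \<and> f e' \<in> {1..}} f)"
        using that finB by (intro member_le_sum) auto
      finally show False using small nonneg(1) nonneg(2,3)[of f] unfolding h_def by linarith
    qed
    define M where "M = {e \<in> E. f e \<noteq> 0}"
    have ME: "M \<subseteq> E" by (auto simp: M_def)
    have f: "f = (\<lambda>e. of_bool (e \<in> M))"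
      using outside le1 by (fastforce simp: M_def fun_eq_iff le_Suc_eq)
    define m where "m = card M"
    have Rf: "pmf R f = q ^ m * exp (- q) ^ card E"
      using pmf_Po_process_indicator[OF finE ME q(1)] by (simp add: R_def m_def flip: f)
    have "(\<Sum>e\<in>E. 2 * real D * p * indicator {f. f e \<in> {1..}} f) = 2 * real D * p * (\<Sum>e\<in>E. of_bool (e \<in> M))"
      unfolding sum_distrib_left by (intro sum.cong) (auto simp: M_def indicator_def)
    also have "(\<Sum>e\<in>E. of_bool (e \<in> M)) = real m"
      using finE ME by (simp add: m_def of_bool_def sum.If_cases Int_absorb1)
    finally have h: "card E * q\<^sup>2 + 2 * real D * p * m \<le> h f"
      using nonneg(3,4)[of f] by (simp add: h_def)
    \<comment> \<open>The two losses combine additively because X and Y are both at most 1.\<close>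
    define X where "X = 1 - real (card E) * q\<^sup>2"
    define Y where "Y = (1 - p) ^ (2 * D * m)"
    have Y: "0 \<le> Y" "Y \<le> 1" using p by (auto simp: Y_def power_le_one)
    have "1 - real (2 * D * m) * p \<le> Y"
      using Bernoulli_inequality[of "- p" "2 * D * m"] p by (simp add: Y_def)
    moreover have "X \<le> 1" by (simp add: X_def)
    then have "0 \<le> (1 - X) * (1 - Y)" using Y by (intro mult_nonneg_nonneg) auto
    then have "X + Y - 1 \<le> X * Y" by (simp add: algebra_simps)
    ultimately have "1 - h f \<le> X * Y"
      using h by (simp add: X_def algebra_simps)
    then have "pmf R f * (1 - h f) \<le> pmf R f * (X * Y)" by (intro mult_left_mono) auto
    also have "\<dots> = q ^ m * (exp (- q) ^ card E * X) * Y" by (simp add: Rf ac_simps)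
    also have "\<dots> \<le> q ^ m * (1 - q) ^ card E * Y"
      unfolding X_def using Y q by (intro mult_right_mono mult_left_mono one_minus_power_ge_exp) auto
    also have "\<dots> \<le> measure_pmf.prob (random_subset V p) {F. {e \<in> E. e \<subseteq> F} = M}"
      unfolding q_def Y_def m_def
    proof (rule prob_induced_matching_ge[OF V E p deg ME])
      fix g e e' assume *: "g \<in> E" "e \<in> M" "e' \<in> M" "g \<inter> e \<noteq> {}" "g \<inter> e' \<noteq> {}"
      then have "f e \<noteq> 0" "f e' \<noteq> 0" by (simp_all add: M_def)
      then have "(e, e') \<notin> B" using unlinked[of e e'] by auto
      then show "e = e'" using * ME by (auto simp: B_def)
    qed
    also have "\<dots> \<le> pmf P f"
      unfolding P_def pmf_map
      by (intro measure_pmf.finite_measure_mono) (auto simp: f edge_indicator_def fun_eq_iff)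
    finally show ?thesis by (simp add: algebra_simps)
  qed
  have int: "integrable (measure_pmf R) (indicator S :: _ \<Rightarrow> real)" for S
    by (rule integrable_real_indicator) (auto simp: measure_pmf.emeasure_eq_measure)
  have inth: "integrable (measure_pmf R) h"
    unfolding h_def[abs_def] case_prod_unfold
    by (intro Bochner_Integration.integrable_add Bochner_Integration.integrable_sum
        integrable_mult_right int measure_pmf.integrable_const)
  have tail1: "measure_pmf.prob R {f. f e \<in> {1..}} \<le> q"
    and tail2: "measure_pmf.prob R {f. f e \<in> {2..}} \<le> q\<^sup>2" if "e \<in> E" for e
    using Po_tail[OF q(1)] unfolding R_def prob_Pi_pmf_component[OF finE that] by simp_all
  have tail12: "measure_pmf.prob R {f. f e \<in> {1..} \<and> f e' \<in> {1..}} \<le> q\<^sup>2" if "(e, e') \<in> B" for e e'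
    using that Po_tail(1)[OF q(1)] unfolding R_def
    by (subst prob_Pi_pmf_two_components[OF finE])
      (auto simp: B_def power2_eq_square intro!: mult_mono q)
  have "measure_pmf.expectation R h = (card E * q\<^sup>2
        + (\<Sum>e\<in>E. 2 * real D * p * measure_pmf.prob R {f. f e \<in> {1..}}))
      + ((\<Sum>e\<in>E. measure_pmf.prob R {f. f e \<in> {2..}})
      + (\<Sum>(e, e')\<in>B. measure_pmf.prob R {f. f e \<in> {1..} \<and> f e' \<in> {1..}}))"
    unfolding h_def[abs_def] case_prod_unfold
    by (simp add: int del: atLeast_iff)
  also have "\<dots> \<le> (card E * q\<^sup>2 + (\<Sum>e\<in>E. 2 * real D * p * q)) + ((\<Sum>e\<in>E. q\<^sup>2) + (\<Sum>(e, e')\<in>B. q\<^sup>2))"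
    using p tail1 tail2 tail12
    by (intro add_mono sum_mono order_refl mult_left_mono) auto
  also have "\<dots> = card E * (2 * q\<^sup>2 + 2 * real D * p * q) + card B * q\<^sup>2"
    by (simp add: algebra_simps)
  also have "card B * q\<^sup>2 \<le> (4 * D\<^sup>2 * card E) * q\<^sup>2"
    using card_linked_pairs_le[OF V E deg] unfolding B_def[symmetric]
    by (intro mult_right_mono) (simp_all flip: of_nat_mult of_nat_power add: of_nat_le_iff)
  also have "card E * (2 * q\<^sup>2 + 2 * real D * p * q) + (4 * D\<^sup>2 * card E) * q\<^sup>2
      = card E * (2 * p ^ 4 + 2 * real D * p ^ 3 + 4 * (real D)\<^sup>2 * p ^ 4)"
    by (simp add: q_def algebra_simps eval_nat_numeral)
  finally have bound: "measure_pmf.expectation R h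
      \<le> card E * (2 * p ^ 4 + 2 * real D * p ^ 3 + 4 * (real D)\<^sup>2 * p ^ 4)" by simp
  have "d_TV P R \<le> measure_pmf.expectation R h"
    by (rule d_TV_le_density[OF inth _ dens]) (unfold h_def, intro add_nonneg_nonneg nonneg)
  then show ?thesis using bound by (simp add: P_def R_def q_def)
qed

section \<open>Counting overlapping pairs\<close>

text \<open>A set \<open>B\<close> is determined by its parts inside and outside \<open>A\<close>. For \<open>j > k\<close> both sides vanish.\<close>

lemma card_fixed_intersection:
  assumes X: "finite X" "A \<subseteq> X" and k: "card A = k"
  shows "card {B \<in> [X]\<^bsup>k\<^esup>. card (A \<inter> B) = j} = (k choose j) * ((card X - k) choose (k - j))"
proof (cases "j \<le> k")
  case True
  have finA: "finite A" using X finite_subset by auto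
  let ?L = "{S. S \<subseteq> A \<and> card S = j} \<times> {T. T \<subseteq> X - A \<and> card T = k - j}"
  let ?R = "{B \<in> [X]\<^bsup>k\<^esup>. card (A \<inter> B) = j}"
  have "bij_betw (\<lambda>(S, T). S \<union> T) ?L ?R"
  proof (rule bij_betw_byWitness[where f' = "\<lambda>B. (A \<inter> B, B - A)"])
    show "\<forall>ST\<in>?L. (A \<inter> (case ST of (S, T) \<Rightarrow> S \<union> T), (case ST of (S, T) \<Rightarrow> S \<union> T) - A) = ST"
      by auto
    show "\<forall>B\<in>?R. (case (A \<inter> B, B - A) of (S, T) \<Rightarrow> S \<union> T) = B" by auto
    show "(\<lambda>(S, T). S \<union> T) ` ?L \<subseteq> ?R"
    proof clarify
      fix S T assume ST: "S \<subseteq> A" "T \<subseteq> X - A" "j = card S" "card T = k - card S"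
      then have fin: "finite S" "finite T" using X finA by (auto intro: finite_subset)
      have "A \<inter> (S \<union> T) = S" "S \<inter> T = {}" using ST by auto
      moreover have "card (S \<union> T) = k"
        using card_Un_disjoint[OF fin \<open>S \<inter> T = {}\<close>] ST True by simp
      ultimately show "S \<union> T \<in> [X]\<^bsup>k\<^esup> \<and> card (A \<inter> (S \<union> T)) = card S"
        using ST X fin by (auto simp: nsets_def)
    qed
    show "(\<lambda>B. (A \<inter> B, B - A)) ` ?R \<subseteq> ?L"
      by (auto simp: nsets_def card_Diff_subset_Int Int_commute)
  qed
  then have "card ?R = card ?L" by (simp add: bij_betw_same_card)
  also have "\<dots> = (k choose j) * ((card X - k) choose (k - j))"
    using X k finA by (simp add: card_cartesian_product n_subsets card_Diff_subset)
  finally show ?thesis .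
next
  case False
  have "finite A" using X finite_subset by auto
  then have "card (A \<inter> B) \<le> k" for B using k card_mono[of A "A \<inter> B"] by auto
  then have "{B \<in> [X]\<^bsup>k\<^esup>. card (A \<inter> B) = j} = {}" using False by auto
  then show ?thesis using False by (simp only: card.empty) (simp add: binomial_eq_0)
qed

lemma doubleton_in_overlap_pairs:
  "{A, B} \<in> overlap_pairs F j \<longleftrightarrow> A \<in> F \<and> B \<in> F \<and> A \<noteq> B \<and> card (A \<inter> B) = j"
proof
  assume "{A, B} \<in> overlap_pairs F j"
  then obtain A' B' where "{A, B} = {A', B'}" "A' \<in> F" "B' \<in> F" "A' \<noteq> B'" "card (A' \<inter> B') = j"
    unfolding overlap_pairs_def by blast
  then show "A \<in> F \<and> B \<in> F \<and> A \<noteq> B \<and> card (A \<inter> B) = j"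
    by (metis Int_commute doubleton_eq_iff)
qed (unfold overlap_pairs_def, blast)

lemma overlap_pairs_subset_nsets: "overlap_pairs F j \<subseteq> [F]\<^bsup>2\<^esup>"
  unfolding overlap_pairs_def by auto

lemma overlap_pairs_subfamily:
  "F \<subseteq> G \<Longrightarrow> overlap_pairs F j = {e \<in> overlap_pairs G j. e \<subseteq> F}"
  unfolding overlap_pairs_def by blast

lemma overlap_pairs_card_Inter: "e \<in> overlap_pairs F j \<Longrightarrow> card (\<Inter>e) = j"
  unfolding overlap_pairs_def by auto

lemma overlap_pairs_full_overlap: "overlap_pairs ([X]\<^bsup>k\<^esup>) k = {}"
proof -
  have "A = B" if "A \<in> [X]\<^bsup>k\<^esup>" "B \<in> [X]\<^bsup>k\<^esup>" "card (A \<inter> B) = k" for A B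
  proof -
    have "A \<inter> B = A" "A \<inter> B = B"
      by (intro card_subset_eq; use that in \<open>simp add: nsets_def\<close>)+
    then show ?thesis by simp
  qed
  then show ?thesis by (auto simp: overlap_pairs_def)
qed

lemma overlap_degree:
  assumes X: "finite X" and A: "A \<in> [X]\<^bsup>k\<^esup>" and j: "j \<noteq> k"
  shows "card {e \<in> overlap_pairs ([X]\<^bsup>k\<^esup>) j. A \<in> e} = (k choose j) * ((card X - k) choose (k - j))"
proof -
  let ?N = "{B \<in> [X]\<^bsup>k\<^esup>. card (A \<inter> B) = j}"
  have A': "A \<subseteq> X" "card A = k" using A by (auto simp: nsets_def)
  have "{e \<in> overlap_pairs ([X]\<^bsup>k\<^esup>) j. A \<in> e} = (\<lambda>B. {A, B}) ` ?N"
  proof (intro equalityI subsetI)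
    fix e assume "e \<in> {e \<in> overlap_pairs ([X]\<^bsup>k\<^esup>) j. A \<in> e}"
    then have e: "e \<in> overlap_pairs ([X]\<^bsup>k\<^esup>) j" "A \<in> e" by auto
    then have "e \<in> [[X]\<^bsup>k\<^esup>]\<^bsup>2\<^esup>"
      using overlap_pairs_subset_nsets by blast
    then obtain B C where "e = {B, C}" by (rule nsets2_E)
    with e(2) obtain D where "e = {A, D}" by (metis insertE insert_commute singletonD)
    with e show "e \<in> (\<lambda>B. {A, B}) ` ?N"
      by (auto simp: doubleton_in_overlap_pairs)
  next
    fix e assume "e \<in> (\<lambda>B. {A, B}) ` ?N"
    then obtain B where "B \<in> ?N" "e = {A, B}" by auto
    with A A' j show "e \<in> {e \<in> overlap_pairs ([X]\<^bsup>k\<^esup>) j. A \<in> e}"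
      by (auto simp: doubleton_in_overlap_pairs)
  qed
  moreover have "inj_on (\<lambda>B. {A, B}) ?N"
    by (auto simp: inj_on_def doubleton_eq_iff)
  ultimately show ?thesis
    using card_fixed_intersection[OF X A'] by (simp add: card_image)
qed

lemma handshake:
  assumes "finite V" "E \<subseteq> [V]\<^bsup>2\<^esup>" "\<And>v. v \<in> V \<Longrightarrow> card {e \<in> E. v \<in> e} = d"
  shows "2 * card E = card V * d"
proof -
  have "finite E" by (rule finite_subset[OF assms(2) finite_imp_finite_nsets[OF assms(1)]])
  moreover have "\<forall>e\<in>E. card {v \<in> V. v \<in> e} = 2"
  proof
    fix e assume "e \<in> E"
    then have "e \<subseteq> V" "card e = 2" using assms(2) by (auto simp: nsets_def)
    moreover from this have "{v \<in> V. v \<in> e} = e" by auto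
    ultimately show "card {v \<in> V. v \<in> e} = 2" by simp
  qed
  ultimately have "(\<Sum>v\<in>V. card {e \<in> E. v \<in> e}) = 2 * card E"
    using assms(1) by (intro sum_multicount) auto
  then show ?thesis using assms(3) by simp
qed

lemma card_overlap_pairs:
  assumes "finite X" "j \<noteq> k"
  shows "2 * card (overlap_pairs ([X]\<^bsup>k\<^esup>) j)
    = (card X choose k) * ((k choose j) * ((card X - k) choose (k - j)))"
proof -
  have "2 * card (overlap_pairs ([X]\<^bsup>k\<^esup>) j)
      = card ([X]\<^bsup>k\<^esup>) * ((k choose j) * ((card X - k) choose (k - j)))"
    by (rule handshake[OF finite_imp_finite_nsets[OF assms(1)] overlap_pairs_subset_nsets])
      (rule overlap_degree[OF assms(1) _ assms(2)])
  then show ?thesis by (simp only: card_nsets)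
qed

lemma random_family_eq: "random_family n k p = random_subset ([{..<n}]\<^bsup>k\<^esup>) p"
  by (simp add: random_family_def random_subset_def)

lemma prob_pair_selected:
  assumes "finite V" "e \<in> [V]\<^bsup>2\<^esup>" "0 \<le> p" "p \<le> 1"
  shows "measure_pmf.prob (random_subset V p) {F. e \<subseteq> F} = p\<^sup>2"
proof -
  have "e \<subseteq> V" "card e = 2" using assms(2) by (simp_all add: nsets_def)
  then show ?thesis using prob_superset[OF assms(1) _ assms(3,4), of e] by simp
qed

lemma expectation_overlap_count:
  assumes "0 \<le> p" "p \<le> 1" "j \<noteq> k"
  shows "measure_pmf.expectation (random_family n k p) (\<lambda>F. real (overlap_count F j))
    = overlap_mean n k p j"
proof -
  define V where "V = [{..<n}]\<^bsup>k\<^esup>"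
  define E where "E = overlap_pairs V j"
  have V: "finite V" by (simp add: V_def finite_imp_finite_nsets)
  have E: "E \<subseteq> [V]\<^bsup>2\<^esup>" by (simp add: E_def overlap_pairs_subset_nsets)
  have finE: "finite E" by (rule finite_subset[OF E finite_imp_finite_nsets[OF V]])
  have "measure_pmf.expectation (random_family n k p) (\<lambda>F. real (overlap_count F j))
      = subset_expectation V p (\<lambda>F. \<Sum>e\<in>E. indicator {F. e \<subseteq> F} F)"
    unfolding random_family_eq V_def[symmetric]
  proof (rule subset_expectation_cong)
    fix F assume "F \<subseteq> V"
    then have "overlap_count F j = card {e \<in> E. e \<subseteq> F}"
      by (simp add: overlap_count_def E_def overlap_pairs_subfamily[of F V])
    then show "real (overlap_count F j) = (\<Sum>e\<in>E. indicator {F. e \<subseteq> F} F)"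
      using finE by (simp add: indicator_def sum.If_cases Int_def)
  qed
  also have "\<dots> = (\<Sum>e\<in>E. measure_pmf.prob (random_subset V p) {F. e \<subseteq> F})"
    using V by (subst Bochner_Integration.integral_sum) auto
  also have "\<dots> = card E * p\<^sup>2"
    using E V assms by (subst sum.cong[OF refl prob_pair_selected[of V]]) auto
  also have "2 * card E = (n choose k) * ((k choose j) * ((n - k) choose (k - j)))"
    using card_overlap_pairs[of "{..<n}" j k] assms(3) by (simp add: E_def V_def)
  then have "real (card E) = 1 / 2 * real ((n choose k) * ((k choose j) * ((n - k) choose (k - j))))"
    by linarith
  finally show ?thesis by (simp add: overlap_mean_def)
qed

section \<open>Poisson approximation of the overlap counts\<close>

text \<open>For \<open>b < k\<close> this is the degree of every vertex in the graph whose edges are the close pairs. For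
\<open>b \<ge> k\<close> it exceeds the degree by 1, since the summand at \<open>j = k\<close> counts a set as its own neighbour.\<close>

definition overlap_degree_sum :: "nat \<Rightarrow> nat \<Rightarrow> nat \<Rightarrow> nat" where
  "overlap_degree_sum n k b = (\<Sum>j\<le>b. (k choose j) * ((n - k) choose (k - j)))"

definition close_pairs :: "nat \<Rightarrow> nat \<Rightarrow> nat \<Rightarrow> nat set set set" where
  "close_pairs n k b = (\<Union>j\<le>b. overlap_pairs ([{..<n}]\<^bsup>k\<^esup>) j)"

lemma close_pairs_subset_nsets: "close_pairs n k b \<subseteq> [[{..<n}]\<^bsup>k\<^esup>]\<^bsup>2\<^esup>"
  using overlap_pairs_subset_nsets unfolding close_pairs_def by blast

lemma finite_ksets: "finite ([{..<n::nat}]\<^bsup>k\<^esup>)"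
  by (simp add: finite_imp_finite_nsets)

lemma finite_close_pairs: "finite (close_pairs n k b)"
  by (rule finite_subset[OF close_pairs_subset_nsets finite_imp_finite_nsets[OF finite_ksets]])

lemma close_pairs_fibre:
  assumes "j \<le> b"
  shows "{e. e \<in> close_pairs n k b \<and> card (\<Inter>e) = j} = overlap_pairs ([{..<n}]\<^bsup>k\<^esup>) j"
  using assms unfolding close_pairs_def by (auto dest: overlap_pairs_card_Inter)

lemma close_pairs_degree_le:
  assumes "b < k" "A \<in> [{..<n}]\<^bsup>k\<^esup>"
  shows "card {e \<in> close_pairs n k b. A \<in> e} \<le> overlap_degree_sum n k b"
proof -
  have "{e \<in> close_pairs n k b. A \<in> e} = (\<Union>j\<le>b. {e \<in> overlap_pairs ([{..<n}]\<^bsup>k\<^esup>) j. A \<in> e})"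
    unfolding close_pairs_def by blast
  then have "card {e \<in> close_pairs n k b. A \<in> e}
      \<le> (\<Sum>j\<le>b. card {e \<in> overlap_pairs ([{..<n}]\<^bsup>k\<^esup>) j. A \<in> e})"
    using card_UN_le[of "{..b}"] by simp
  also have "\<dots> = overlap_degree_sum n k b"
    unfolding overlap_degree_sum_def
    by (intro sum.cong) (use assms in \<open>simp_all add: overlap_degree\<close>)
  finally show ?thesis .
qed

lemma card_close_pairs_le:
  "2 * card (close_pairs n k b) \<le> (n choose k) * overlap_degree_sum n k b"
proof -
  have "2 * card (close_pairs n k b) \<le> (\<Sum>j\<le>b. 2 * card (overlap_pairs ([{..<n}]\<^bsup>k\<^esup>) j))"
    unfolding close_pairs_def sum_distrib_left[symmetric]
    by (intro mult_le_mono2 card_UN_le) simp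
  also have "\<dots> \<le> (\<Sum>j\<le>b. (n choose k) * ((k choose j) * ((n - k) choose (k - j))))"
  proof (rule sum_mono)
    fix j
    show "2 * card (overlap_pairs ([{..<n}]\<^bsup>k\<^esup>) j)
        \<le> (n choose k) * ((k choose j) * ((n - k) choose (k - j)))"
      using card_overlap_pairs[of "{..<n}" j k]
      by (cases "j = k") (simp_all add: overlap_pairs_full_overlap)
  qed
  finally show ?thesis by (simp add: overlap_degree_sum_def sum_distrib_left)
qed

text \<open>The class of a close pair \<open>e\<close> is the size of the intersection of its two sets.\<close>

lemma overlap_vector_pmf_eq_map_edge_indicator:
  "overlap_vector_pmf n k p b =
    map_pmf (\<lambda>f j. \<Sum>e | e \<in> close_pairs n k b \<and> card (\<Inter>e) = j. f e)
      (map_pmf (edge_indicator (close_pairs n k b)) (random_subset ([{..<n}]\<^bsup>k\<^esup>) p))"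
  unfolding overlap_vector_pmf_def random_family_eq map_pmf_comp
proof (rule map_pmf_cong[OF refl], rule ext)
  fix F j
  assume "F \<in> set_pmf (random_subset ([{..<n}]\<^bsup>k\<^esup>) p)"
  then have F: "F \<subseteq> [{..<n}]\<^bsup>k\<^esup>" using set_random_subset by blast
  let ?E = "close_pairs n k b"
  show "(if j \<le> b then overlap_count F j else 0)
      = (\<Sum>e | e \<in> ?E \<and> card (\<Inter>e) = j. edge_indicator ?E F e)"
  proof (cases "j \<le> b")
    case True
    have "(\<Sum>e | e \<in> ?E \<and> card (\<Inter>e) = j. edge_indicator ?E F e)
        = (\<Sum>e | e \<in> ?E \<and> card (\<Inter>e) = j. if e \<subseteq> F then 1 else 0)"
      by (intro sum.cong) (auto simp: edge_indicator_def)
    also have "\<dots> = card {e \<in> {e. e \<in> ?E \<and> card (\<Inter>e) = j}. e \<subseteq> F}"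
      using finite_close_pairs by (simp add: sum.If_cases Int_def)
    also have "\<dots> = overlap_count F j"
      unfolding close_pairs_fibre[OF True] overlap_count_def overlap_pairs_subfamily[OF F] ..
    finally show ?thesis using True by simp
  next
    case False
    then have empty: "{e. e \<in> ?E \<and> card (\<Inter>e) = j} = {}"
      using overlap_pairs_card_Inter unfolding close_pairs_def by blast
    show ?thesis using False unfolding empty by simp
  qed
qed

lemma overlap_mean_eq_card:
  assumes "j \<noteq> k"
  shows "overlap_mean n k p j = real (card (overlap_pairs ([{..<n}]\<^bsup>k\<^esup>) j)) * p\<^sup>2"
proof -
  have "2 * card (overlap_pairs ([{..<n}]\<^bsup>k\<^esup>) j)
      = (n choose k) * ((k choose j) * ((n - k) choose (k - j)))"
    using card_overlap_pairs[of "{..<n}" j k] assms by simp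
  then have "real (card (overlap_pairs ([{..<n}]\<^bsup>k\<^esup>) j))
      = 1 / 2 * real ((n choose k) * ((k choose j) * ((n - k) choose (k - j))))"
    by linarith
  then show ?thesis by (simp add: overlap_mean_def)
qed

text \<open>Total variation distance does not increase when edges are aggregated into counts. The restriction
\<open>b < k\<close> makes every \<open>overlap_mean\<close> the true mean of the corresponding count.\<close>

lemma d_TV_overlap_vector_le_sparse:
  fixes n k b :: nat and p :: real
  assumes p: "0 \<le> p" "p \<le> 1" and "b < k"
  defines "S \<equiv> overlap_degree_sum n k b"
  shows "d_TV (overlap_vector_pmf n k p b) (Po_product b (overlap_mean n k p))
    \<le> card (close_pairs n k b) * (2 * p ^ 4 + 2 * real S * p ^ 3 + 4 * (real S)\<^sup>2 * p ^ 4)"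
proof -
  define E where "E = close_pairs n k b"
  define counts :: "(nat set set \<Rightarrow> nat) \<Rightarrow> nat \<Rightarrow> nat" where
    "counts = (\<lambda>f j. \<Sum>e | e \<in> E \<and> card (\<Inter>e) = j. f e)"
  have range: "(\<lambda>e. card (\<Inter>e)) ` E \<subseteq> {..b}"
    unfolding E_def close_pairs_def by (auto dest: overlap_pairs_card_Inter)
  have "Po_product b (overlap_mean n k p)
      = Pi_pmf {..b} 0 (\<lambda>j. Po (real (card {e \<in> E. card (\<Inter>e) = j}) * p\<^sup>2))"
    unfolding Po_product_def E_def
    by (intro Pi_pmf_cong refl)
      (use \<open>b < k\<close> in \<open>simp add: overlap_mean_eq_card close_pairs_fibre\<close>)
  also have "\<dots> = map_pmf counts (Pi_pmf E 0 (\<lambda>_. Po (p\<^sup>2)))"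
    unfolding counts_def
    by (intro map_pmf_fibre_sums_Po[symmetric] range) (simp_all add: E_def finite_close_pairs)
  finally have R: "Po_product b (overlap_mean n k p) = map_pmf counts (Pi_pmf E 0 (\<lambda>_. Po (p\<^sup>2)))" .
  have "d_TV (overlap_vector_pmf n k p b) (Po_product b (overlap_mean n k p))
      \<le> d_TV (map_pmf (edge_indicator E) (random_subset ([{..<n}]\<^bsup>k\<^esup>) p)) (Pi_pmf E 0 (\<lambda>_. Po (p\<^sup>2)))"
    unfolding R overlap_vector_pmf_eq_map_edge_indicator counts_def E_def by (rule d_TV_map_pmf_le)
  also have "\<dots> \<le> card E * (2 * p ^ 4 + 2 * real S * p ^ 3 + 4 * (real S)\<^sup>2 * p ^ 4)"
    unfolding E_def S_def
    by (rule d_TV_induced_edges_Po_process_le[OF finite_ksets close_pairs_subset_nsets p])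
      (rule close_pairs_degree_le[OF \<open>b < k\<close>])
  finally show ?thesis by (simp add: E_def)
qed

lemma overlap_mean_nonneg: "0 \<le> overlap_mean n k p j"
  by (simp add: overlap_mean_def)

lemma sum_overlap_mean:
  "(\<Sum>j\<le>b. overlap_mean n k p j) = real (n choose k) * overlap_degree_sum n k b * p\<^sup>2 / 2"
  by (simp add: overlap_mean_def overlap_degree_sum_def sum_distrib_left sum_distrib_right
      sum_divide_distrib mult_ac)

text \<open>Both vectors are compared with the zero vector. Either one differs from it with probability at most
half the bound, by a union bound over the close pairs and by \<open>exp (- x) \<ge> 1 - x\<close>.\<close>

lemma d_TV_overlap_vector_le_empty:
  assumes p: "0 \<le> p" "p \<le> 1"
  shows "d_TV (overlap_vector_pmf n k p b) (Po_product b (overlap_mean n k p))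
    \<le> real (n choose k) * overlap_degree_sum n k b * p\<^sup>2"
proof -
  define V where "V = [{..<n}]\<^bsup>k\<^esup>"
  define E where "E = close_pairs n k b"
  define m where "m = real (n choose k) * overlap_degree_sum n k b * p\<^sup>2 / 2"
  let ?vec = "\<lambda>F j. if j \<le> b then overlap_count F j else 0"
  have V: "finite V" and finE: "finite E"
    by (simp_all add: V_def E_def finite_ksets finite_close_pairs)
  have "real (card E) \<le> real (n choose k) * overlap_degree_sum n k b / 2"
    using card_close_pairs_le[of n k b] unfolding E_def
    by (simp flip: of_nat_mult add: mult.commute)
  then have "1 - m \<le> 1 - card E * p\<^sup>2"
    unfolding m_def using mult_right_mono[of "real (card E)" _ "p\<^sup>2"] by fastforce
  also have "card E * p\<^sup>2 = (\<Sum>e\<in>E. measure_pmf.prob (random_subset V p) {F. e \<subseteq> F})"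
  proof -
    have "measure_pmf.prob (random_subset V p) {F. e \<subseteq> F} = p\<^sup>2" if "e \<in> E" for e
      using that close_pairs_subset_nsets[of n k b] unfolding E_def V_def
      by (intro prob_pair_selected finite_ksets p) blast
    then show ?thesis by simp
  qed
  also have "1 - \<dots> = subset_expectation V p (\<lambda>F. 1 - (\<Sum>e\<in>E. indicator {F. e \<subseteq> F} F))"
    using V by simp
  also have "\<dots> \<le> subset_expectation V p (indicator {F. ?vec F = (\<lambda>_. 0)})"
  proof (rule subset_expectation_mono[OF V])
    fix F assume F: "F \<subseteq> V"
    show "1 - (\<Sum>e\<in>E. indicator {F. e \<subseteq> F} F) \<le> (indicator {F. ?vec F = (\<lambda>_. 0)} F :: real)"
    proof (cases "\<exists>e\<in>E. e \<subseteq> F")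
      case True
      then obtain e where e: "e \<in> E" "e \<subseteq> F" by blast
      then have "1 \<le> (indicator {F. e \<subseteq> F} F :: real)" by simp
      also have "\<dots> \<le> (\<Sum>e\<in>E. indicator {F. e \<subseteq> F} F)"
        using e finE by (intro member_le_sum) auto
      finally have "1 - (\<Sum>e\<in>E. indicator {F. e \<subseteq> F} F) \<le> (0 :: real)" by simp
      then show ?thesis by (rule order_trans) simp
    next
      case False
      then have "overlap_pairs F j = {}" if "j \<le> b" for j
        using that unfolding overlap_pairs_subfamily[OF F] E_def close_pairs_def V_def by blast
      then have "?vec F = (\<lambda>_. 0)" by (simp add: overlap_count_def fun_eq_iff)
      then show ?thesis by (simp add: sum_nonneg)
    qed
  qed
  also have "\<dots> = pmf (overlap_vector_pmf n k p b) (\<lambda>_. 0)"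
    by (simp add: overlap_vector_pmf_def random_family_eq pmf_map V_def vimage_def)
  finally have P0: "1 - m \<le> pmf (overlap_vector_pmf n k p b) (\<lambda>_. 0)" .
  have "1 - m = 1 + (- (\<Sum>j\<le>b. overlap_mean n k p j))"
    by (simp add: sum_overlap_mean m_def)
  also have "\<dots> \<le> exp (- (\<Sum>j\<le>b. overlap_mean n k p j))" by (rule exp_ge_add_one_self)
  also have "\<dots> = pmf (Po_product b (overlap_mean n k p)) (\<lambda>_. 0)"
    unfolding Po_product_def
    by (subst pmf_Pi') (simp_all add: pmf_Po overlap_mean_nonneg exp_sum flip: sum_negf)
  finally have "1 - m \<le> pmf (Po_product b (overlap_mean n k p)) (\<lambda>_. 0)" .
  with P0 have "d_TV (overlap_vector_pmf n k p b) (Po_product b (overlap_mean n k p)) \<le> 2 * m"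
    using d_TV_le_common_atom[of "overlap_vector_pmf n k p b" "Po_product b (overlap_mean n k p)" "\<lambda>_. 0"]
    by linarith
  then show ?thesis by (simp add: m_def)
qed

lemma overlap_degree_sum_vandermonde:
  assumes "k \<le> n"
  shows "overlap_degree_sum n k b \<le> n choose k" "k \<le> b \<Longrightarrow> overlap_degree_sum n k b = n choose k"
proof -
  let ?d = "\<lambda>j. (k choose j) * ((n - k) choose (k - j))"
  have full: "(\<Sum>j\<le>k. ?d j) = n choose k"
    using vandermonde[of k "n - k" k] assms by simp
  have outside: "(\<Sum>j\<in>A. ?d j) = (\<Sum>j\<in>A \<inter> {..k}. ?d j)" if "finite A" for A
    using that by (intro sum.mono_neutral_right) (auto simp: binomial_eq_0)
  have "overlap_degree_sum n k b = (\<Sum>j\<in>{..b} \<inter> {..k}. ?d j)"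
    unfolding overlap_degree_sum_def by (rule outside) simp
  moreover have "(\<Sum>j\<in>{..b} \<inter> {..k}. ?d j) \<le> (\<Sum>j\<le>k. ?d j)"
    by (intro sum_mono2) auto
  moreover have "{..b} \<inter> {..k} = {..k}" if "k \<le> b" using that by auto
  ultimately show "overlap_degree_sum n k b \<le> n choose k"
    "k \<le> b \<Longrightarrow> overlap_degree_sum n k b = n choose k"
    using full by simp_all
qed

lemma overlap_degree_sum_pos:
  assumes "2 * k \<le> n"
  shows "0 < overlap_degree_sum n k b"
proof -
  have "0 < (k choose 0) * ((n - k) choose (k - 0))"
    using assms by simp
  also have "\<dots> \<le> overlap_degree_sum n k b"
    unfolding overlap_degree_sum_def by (rule member_le_sum) auto
  finally show ?thesis .
qed

text \<open>Here \<open>t\<close> is the ratio of \<open>p\<close> to the threshold \<open>(1 / (N S\<^sup>2)) powr (1/3)\<close>. In the case \<open>b < k\<close> the inequality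
\<open>S \<le> N\<close> yields \<open>S p \<le> t\<close>, and the error is of order \<open>t^3\<close>. In the case \<open>b \<ge> k\<close> one has \<open>S = N\<close>, hence
\<open>t = N p\<close>, and the error is of order \<open>t\<^sup>2\<close>.\<close>

lemma d_TV_overlap_vector_le:
  assumes k: "2 * k \<le> n" and p: "0 \<le> p" "p \<le> 1" and t: "0 \<le> t" "t \<le> 1"
    and t3: "t ^ 3 = real (n choose k) * (overlap_degree_sum n k b)\<^sup>2 * p ^ 3"
  shows "d_TV (overlap_vector_pmf n k p b) (Po_product b (overlap_mean n k p)) \<le> 4 * t\<^sup>2"
    (is "?d \<le> _")
proof -
  define N where "N = real (n choose k)"
  define S where "S = real (overlap_degree_sum n k b)"
  have S: "1 \<le> S" "S \<le> N"
    using overlap_degree_sum_pos[OF k, of b] overlap_degree_sum_vandermonde(1)[of k n b] k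
    by (simp_all add: S_def N_def)
  have t3': "t ^ 3 = N * S\<^sup>2 * p ^ 3" using t3 by (simp add: N_def S_def)
  show ?thesis
  proof (cases "b < k")
    case True
    have "(S * p) ^ 3 = S * S\<^sup>2 * p ^ 3" by (simp add: power_mult_distrib eval_nat_numeral)
    also have "\<dots> \<le> t ^ 3" unfolding t3' using S p by (intro mult_right_mono) auto
    finally have "S * p \<le> t" using power_le_imp_le_base[of "S * p" 2 t] t(1) by simp
    then have Sp: "S * p \<le> 1" using t by simp
    have Np: "0 \<le> N * S * p ^ 3" using S p by simp
    have "2 * real (card (close_pairs n k b)) \<le> N * S"
      using card_close_pairs_le[of n k b] unfolding N_def S_def
      by (simp flip: of_nat_mult)
    then have "card (close_pairs n k b) * (2 * p ^ 4 + 2 * S * p ^ 3 + 4 * S\<^sup>2 * p ^ 4)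
        \<le> (N * S / 2) * (2 * p ^ 4 + 2 * S * p ^ 3 + 4 * S\<^sup>2 * p ^ 4)"
      using S p by (intro mult_right_mono add_nonneg_nonneg) auto
    then have "?d \<le> (N * S / 2) * (2 * p ^ 4 + 2 * S * p ^ 3 + 4 * S\<^sup>2 * p ^ 4)"
      using d_TV_overlap_vector_le_sparse[OF p True, of n] unfolding S_def by linarith
    also have "\<dots> = N * S * p ^ 3 * p + t ^ 3 + 2 * (t ^ 3 * (S * p))"
      unfolding t3' by (simp add: algebra_simps eval_nat_numeral)
    also have "\<dots> \<le> t ^ 3 + t ^ 3 + 2 * (t ^ 3 * 1)"
    proof (intro add_mono order_refl mult_left_mono Sp)
      have "N * S * p ^ 3 * p \<le> N * S * p ^ 3 * S"
        using Np p S by (intro mult_left_mono) auto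
      then show "N * S * p ^ 3 * p \<le> t ^ 3"
        unfolding t3' by (simp add: power2_eq_square mult_ac)
    qed (use t in auto)
    also have "\<dots> = 4 * t ^ 3" by simp
    also have "\<dots> \<le> 4 * t\<^sup>2" using t by (simp add: power_decreasing)
    finally show ?thesis .
  next
    case False
    then have "S = N"
      using overlap_degree_sum_vandermonde(2)[of k n b] k by (simp add: S_def N_def)
    then have "(N * p) ^ 3 = t ^ 3"
      unfolding t3' by (simp add: power_mult_distrib eval_nat_numeral)
    then have "N * p = t"
      using t p S by (subst (asm) power_eq_iff_eq_base) auto
    then have "N * S * p\<^sup>2 = t\<^sup>2"
      using \<open>S = N\<close> by (auto simp: power2_eq_square)
    then have "?d \<le> t\<^sup>2"
      using d_TV_overlap_vector_le_empty[OF p, of n k b] by (simp add: N_def S_def)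
    also have "\<dots> \<le> 4 * t\<^sup>2" by simp
    finally show ?thesis .
  qed
qed

theorem theorem5:
  fixes k b :: "nat \<Rightarrow> nat" and p :: "nat \<Rightarrow> real"
  assumes k_range: "\<forall>\<^sub>F n in sequentially. 0 < k n \<and> 2 * k n < n"
    and k_lim: "filterlim k at_top sequentially"
    and p_range: "\<And>n. 0 \<le> p n \<and> p n \<le> 1"
    and p_small: "p \<in> o[sequentially](\<lambda>n.
          (1 / (real (n choose k n) *
                (\<Sum>j=0..b n. real (k n choose j) * real ((n - k n) choose (k n - j)))\<^sup>2))
          powr (1 / 3))"
  shows "(\<forall>n j. j \<le> b n \<and> j \<noteq> k n \<longrightarrow>
            measure_pmf.expectation (random_family n (k n) (p n)) (\<lambda>F. real (overlap_count F j))
              = overlap_mean n (k n) (p n) j) \<and>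
         (\<exists>\<epsilon> :: nat \<Rightarrow> nat \<Rightarrow> nat \<Rightarrow> real.
            (\<forall>\<^sub>F n in sequentially.
               d_TV (overlap_vector_pmf n (k n) (p n) (b n))
                    (Po_product (b n) (overlap_mean n (k n) (p n))) \<le> \<epsilon> n (b n) (k n)) \<and>
            (\<lambda>n. \<epsilon> n (b n) (k n)) \<longlonglongrightarrow> 0)"
proof (intro conjI allI impI)
  fix n j
  assume "j \<le> b n \<and> j \<noteq> k n"
  then show "measure_pmf.expectation (random_family n (k n) (p n)) (\<lambda>F. real (overlap_count F j))
      = overlap_mean n (k n) (p n) j"
    using p_range expectation_overlap_count by blast
next
  define c where "c n = real (n choose k n) * (real (overlap_degree_sum n (k n) (b n)))\<^sup>2" for n
  define g where "g n = (1 / c n) powr (1 / 3)" for n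
  define t where "t n = p n / g n" for n
  let ?d = "\<lambda>n. d_TV (overlap_vector_pmf n (k n) (p n) (b n))
    (Po_product (b n) (overlap_mean n (k n) (p n)))"
  have "p \<in> o[sequentially](g)"
    using p_small by (simp add: g_def[abs_def] c_def overlap_degree_sum_def atLeast0AtMost)
  then have t0: "t \<longlonglongrightarrow> 0"
    unfolding t_def by (rule smalloD_tendsto)
  then have "\<forall>\<^sub>F n in sequentially. t n < 1" by (rule order_tendstoD) simp
  then have "\<forall>\<^sub>F n in sequentially. ?d n \<le> 4 * (t n)\<^sup>2"
    using k_range
  proof eventually_elim
    case (elim n)
    have "0 < c n"
      using overlap_degree_sum_pos[of "k n" n "b n"] elim by (simp add: c_def)
    then have "g n ^ 3 = 1 / c n"
      unfolding g_def by (simp add: powr_power)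
    then have "t n ^ 3 = c n * p n ^ 3"
      by (simp add: t_def power_divide)
    then show ?case
      using p_range elim
      by (intro d_TV_overlap_vector_le) (auto simp: c_def t_def g_def)
  qed
  moreover have "(\<lambda>n. 4 * (t n)\<^sup>2) \<longlonglongrightarrow> 4 * 0\<^sup>2"
    by (intro tendsto_intros t0)
  ultimately have "?d \<longlonglongrightarrow> 0"
    by (intro tendsto_sandwich[of "\<lambda>_. 0" ?d sequentially "\<lambda>n. 4 * (t n)\<^sup>2"])
      (simp_all add: d_TV_nonneg)
  then show "\<exists>\<epsilon> :: nat \<Rightarrow> nat \<Rightarrow> nat \<Rightarrow> real.
      (\<forall>\<^sub>F n in sequentially. ?d n \<le> \<epsilon> n (b n) (k n)) \<and> (\<lambda>n. \<epsilon> n (b n) (k n)) \<longlonglongrightarrow> 0"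
    by (intro exI[of _ "\<lambda>n _ _. ?d n"]) simp
qed

end
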